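(* Let $0<\mu_1<\mu_2<\cdots$ be the (simple) eigenvalues of an operator $\mathcal L$ as in the context, and suppose: there are $M>0$, $\sigma\in(0,1]$ and $\beta$ with $\mu_n=Mn^{\beta}(1+o(n^{-\sigma}))$ as $n\to\infty$; there are $\theta>0$ and $s\ge 0$ with $\mu_{n+1}-\mu_n\ge\theta n^{-s}$ for all $n\ge1$; and $\sum_{n=1}^\infty\mu_n^{-1}=\infty$. For a sequence $(m_n)_{n\ge1}$ and each $N\ge1$ let $\nu_N=\sum_{n=1}^N m_n\widetilde\varphi_n^{(N)}$, where $\widetilde\varphi^{(N)}_1,\dots,\widetilde\varphi^{(N)}_N\in L^2[0,\infty)$ are the optimal bi-orthogonal functions defined in the context. If $\beta\in[0,1]$, then the series solution $\lim_{N\to\infty}\nu_N$ cannot be absolutely convergent, i.e. the sums $\sum_{n=1}^N|m_n|\,\|\widetilde\varphi_n^{(N)}\|_{L^2[0,\infty)}$ are not bounded as $N\to\infty$, unless $m_n=0$ for all $n$.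
   Context: $\mathcal L$ is a self-adjoint strongly elliptic differential operator with Dirichlet boundary condition on a compact domain $\Omega\subset\mathbb R^d$ with smooth boundary, with positive distinct eigenvalues $0<\mu_1<\mu_2<\cdots$. The moment problem under consideration is $\int_0^\infty e^{-\mu_nt}\nu(t)\,dt=m_n$, $n\ge1$. For each $N$, the functions $\widetilde\varphi_n=\widetilde\varphi_n^{(N)}\in L^2[0,\infty)$, $1\le n\le N$, are those satisfying $\int_0^\infty e^{-\mu_nt}\widetilde\varphi_k(t)\,dt=\delta_{k,n}$ for $1\le k,n\le N$ and having minimal $L^2[0,\infty)$ norm among functions with this property (so $\nu_N$ solves the first $N$ moment equations). *)

theory Defs
  imports "HOL-Analysis.Analysis" "HOL-Library.Landau_Symbols"
begin

section \<open>Square-integrable functions\<close>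

text \<open>Functions are scalar functions with complex values, not classes modulo null sets; statements
  about elements of \<open>L\<^sup>2\<close> are therefore invariant under changes on null sets.\<close>

definition L2 :: "'b measure \<Rightarrow> ('b \<Rightarrow> complex) set" where
  "L2 M = {f \<in> borel_measurable M. integrable M (\<lambda>x. (cmod (f x))\<^sup>2)}"

definition L2norm :: "'b measure \<Rightarrow> ('b \<Rightarrow> complex) \<Rightarrow> real" where
  "L2norm M f = sqrt (LINT x|M. (cmod (f x))\<^sup>2)"

definition L2inner :: "'b measure \<Rightarrow> ('b \<Rightarrow> complex) \<Rightarrow> ('b \<Rightarrow> complex) \<Rightarrow> complex" where
  "L2inner M f g = (LINT x|M. f x * cnj (g x))"

section \<open>Smooth functions and compact domains with smooth boundary\<close>

text \<open>Derivatives are indexed by lists of coordinate directions, \<open>\<partial>\<^sub>I = \<partial>\<^sub>i \<partial>\<^sub>j \<dots>\<close> for \<open>I = [i, j, \<dots>]\<close>,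
  instead of multi-indices; the order of the derivative is \<open>length I\<close>.\<close>

primrec partials :: "'d::finite list \<Rightarrow> (real^'d \<Rightarrow> 'b::real_normed_vector) \<Rightarrow> real^'d \<Rightarrow> 'b" where
  "partials [] f = f"
| "partials (i # I) f = (\<lambda>x. frechet_derivative (partials I f) (at x) (axis i 1))"

definition smooth_on :: "(real^'d::finite) set \<Rightarrow> (real^'d \<Rightarrow> 'b::real_normed_vector) \<Rightarrow> bool" where
  "smooth_on U f \<longleftrightarrow> open U \<and> (\<forall>I. \<forall>x\<in>U. partials I f differentiable (at x))"

text \<open>Near each boundary point, \<open>\<Omega>\<close> is the sublevel set of a smooth function with non-vanishing
  gradient.\<close>

definition smooth_boundary :: "(real^'d::finite) set \<Rightarrow> bool" where
  "smooth_boundary \<Omega> \<longleftrightarrow>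
     (\<forall>p\<in>frontier \<Omega>. \<exists>U (\<rho> :: real^'d \<Rightarrow> real).
        p \<in> U \<and> smooth_on U \<rho> \<and> (\<forall>x\<in>U. \<exists>i. partials [i] \<rho> x \<noteq> 0) \<and> \<rho> p = 0 \<and>
        \<Omega> \<inter> U = {x \<in> U. \<rho> x \<le> 0})"

definition compact_smooth_domain :: "(real^'d::finite) set \<Rightarrow> bool" where
  "compact_smooth_domain \<Omega> \<longleftrightarrow>
     compact \<Omega> \<and> interior \<Omega> \<noteq> {} \<and> connected (interior \<Omega>) \<and> smooth_boundary \<Omega>"

section \<open>Sobolev spaces\<close>

definition test_functions :: "(real^'d::finite) set \<Rightarrow> (real^'d \<Rightarrow> complex) set" where
  "test_functions \<Omega> = {\<psi>. smooth_on UNIV \<psi> \<and> compact (closure {x. \<psi> x \<noteq> 0}) \<and>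
     closure {x. \<psi> x \<noteq> 0} \<subseteq> interior \<Omega>}"

definition has_weak_deriv ::
  "(real^'d::finite) set \<Rightarrow> 'd list \<Rightarrow> (real^'d \<Rightarrow> complex) \<Rightarrow> (real^'d \<Rightarrow> complex) \<Rightarrow> bool" where
  "has_weak_deriv \<Omega> I u w \<longleftrightarrow> u \<in> L2 (lebesgue_on \<Omega>) \<and> w \<in> L2 (lebesgue_on \<Omega>) \<and>
     (\<forall>\<psi>\<in>test_functions \<Omega>.
        (LINT x|lebesgue_on \<Omega>. u x * partials I \<psi> x) =
        (- 1) ^ length I * (LINT x|lebesgue_on \<Omega>. w x * \<psi> x))"

text \<open>Weak derivatives are unique up to null sets.\<close>

definition weak_deriv ::
  "(real^'d::finite) set \<Rightarrow> 'd list \<Rightarrow> (real^'d \<Rightarrow> complex) \<Rightarrow> real^'d \<Rightarrow> complex" where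
  "weak_deriv \<Omega> I u = (SOME w. has_weak_deriv \<Omega> I u w)"

definition Sobolev :: "nat \<Rightarrow> (real^'d::finite) set \<Rightarrow> (real^'d \<Rightarrow> complex) set" where
  "Sobolev k \<Omega> = {u. \<forall>I. length I \<le> k \<longrightarrow> (\<exists>w. has_weak_deriv \<Omega> I u w)}"

text \<open>The closure of the test functions in the norm of \<open>Sobolev k \<Omega>\<close>.\<close>

definition Sobolev0 :: "nat \<Rightarrow> (real^'d::finite) set \<Rightarrow> (real^'d \<Rightarrow> complex) set" where
  "Sobolev0 k \<Omega> = {u \<in> Sobolev k \<Omega>. \<exists>\<psi>. (\<forall>j::nat. \<psi> j \<in> test_functions \<Omega>) \<and>
     (\<forall>I. length I \<le> k \<longrightarrow>
        (\<lambda>j. L2norm (lebesgue_on \<Omega>) (\<lambda>x. partials I (\<psi> j) x - weak_deriv \<Omega> I u x))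
          \<longlonglongrightarrow> 0)}"

section \<open>Self-adjoint strongly elliptic operators with Dirichlet boundary condition\<close>

text \<open>Throughout, \<open>k\<close> is half the order and \<open>a\<close> the family of coefficients of the operator
  \<open>u \<mapsto> \<Sum> a\<^sub>I \<partial>\<^sub>I u\<close> (sum over \<open>length I \<le> 2 * k\<close>), acting in \<open>L\<^sup>2(\<Omega>)\<close> with domain
  \<open>H\<^sup>2\<^sup>k(\<Omega>) \<inter> H\<^sub>0\<^sup>k(\<Omega>)\<close>.\<close>

definition diff_op ::
  "(real^'d::finite) set \<Rightarrow> nat \<Rightarrow> ('d list \<Rightarrow> real^'d \<Rightarrow> complex) \<Rightarrow>
     (real^'d \<Rightarrow> complex) \<Rightarrow> real^'d \<Rightarrow> complex" where
  "diff_op \<Omega> k a u x = (\<Sum>I | length I \<le> 2 * k. a I x * weak_deriv \<Omega> I u x)"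

definition dirichlet_domain :: "(real^'d::finite) set \<Rightarrow> nat \<Rightarrow> (real^'d \<Rightarrow> complex) set" where
  "dirichlet_domain \<Omega> k = Sobolev (2 * k) \<Omega> \<inter> Sobolev0 k \<Omega>"

definition admissible_coeffs ::
  "(real^'d::finite) set \<Rightarrow> nat \<Rightarrow> ('d list \<Rightarrow> real^'d \<Rightarrow> complex) \<Rightarrow> bool" where
  "admissible_coeffs \<Omega> k a \<longleftrightarrow>
     (\<forall>I. length I \<le> 2 * k \<longrightarrow> a I \<in> borel_measurable (lebesgue_on \<Omega>) \<and> bounded (a I ` \<Omega>)) \<and>
     (\<forall>I. length I = 2 * k \<longrightarrow> continuous_on \<Omega> (a I))"

text \<open>The coefficients belong to \<open>\<partial>\<^sub>I\<close>, not to \<open>(-\<i>)\<^bsup>|I|\<^esup> \<partial>\<^sub>I\<close>, whence the sign: for \<open>-\<Delta>\<close> the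
  expression below is \<open>|\<xi>|\<^sup>2\<close>.\<close>

definition strongly_elliptic ::
  "(real^'d::finite) set \<Rightarrow> nat \<Rightarrow> ('d list \<Rightarrow> real^'d \<Rightarrow> complex) \<Rightarrow> bool" where
  "strongly_elliptic \<Omega> k a \<longleftrightarrow>
     (\<exists>c>0. \<forall>x\<in>\<Omega>. \<forall>\<xi>::real^'d.
        Re ((- 1) ^ k * (\<Sum>I | length I = 2 * k. a I x * of_real (prod_list (map (\<lambda>i. \<xi> $ i) I))))
          \<ge> c * norm \<xi> ^ (2 * k))"

text \<open>The graph of the Hilbert space adjoint (left-hand side) is the graph of the operator.\<close>

definition self_adjoint_dirichlet ::
  "(real^'d::finite) set \<Rightarrow> nat \<Rightarrow> ('d list \<Rightarrow> real^'d \<Rightarrow> complex) \<Rightarrow> bool" where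
  "self_adjoint_dirichlet \<Omega> k a \<longleftrightarrow>
     (\<forall>v\<in>L2 (lebesgue_on \<Omega>). \<forall>f\<in>L2 (lebesgue_on \<Omega>).
        (\<forall>u\<in>dirichlet_domain \<Omega> k.
           L2inner (lebesgue_on \<Omega>) (diff_op \<Omega> k a u) v = L2inner (lebesgue_on \<Omega>) u f) \<longleftrightarrow>
        (v \<in> dirichlet_domain \<Omega> k \<and> (AE x in lebesgue_on \<Omega>. diff_op \<Omega> k a v x = f x)))"

definition elliptic_dirichlet_operator ::
  "(real^'d::finite) set \<Rightarrow> nat \<Rightarrow> ('d list \<Rightarrow> real^'d \<Rightarrow> complex) \<Rightarrow> bool" where
  "elliptic_dirichlet_operator \<Omega> k a \<longleftrightarrow>
     compact_smooth_domain \<Omega> \<and> k \<ge> 1 \<and> admissible_coeffs \<Omega> k a \<and>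
     strongly_elliptic \<Omega> k a \<and> self_adjoint_dirichlet \<Omega> k a"

definition eigenspace ::
  "(real^'d::finite) set \<Rightarrow> nat \<Rightarrow> ('d list \<Rightarrow> real^'d \<Rightarrow> complex) \<Rightarrow> complex \<Rightarrow>
     (real^'d \<Rightarrow> complex) set" where
  "eigenspace \<Omega> k a z =
     {u \<in> dirichlet_domain \<Omega> k. AE x in lebesgue_on \<Omega>. diff_op \<Omega> k a u x = z * u x}"

definition eigenvalues ::
  "(real^'d::finite) set \<Rightarrow> nat \<Rightarrow> ('d list \<Rightarrow> real^'d \<Rightarrow> complex) \<Rightarrow> complex set" where
  "eigenvalues \<Omega> k a =
     {z. \<exists>u\<in>eigenspace \<Omega> k a z. \<not> (AE x in lebesgue_on \<Omega>. u x = 0)}"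

definition simple_eigenvalue ::
  "(real^'d::finite) set \<Rightarrow> nat \<Rightarrow> ('d list \<Rightarrow> real^'d \<Rightarrow> complex) \<Rightarrow> complex \<Rightarrow> bool" where
  "simple_eigenvalue \<Omega> k a z \<longleftrightarrow> z \<in> eigenvalues \<Omega> k a \<and>
     (\<exists>u\<in>eigenspace \<Omega> k a z. \<forall>v\<in>eigenspace \<Omega> k a z.
        \<exists>c. AE x in lebesgue_on \<Omega>. v x = c * u x)"

text \<open>Sequences are indexed from 1 on; the value at 0 is irrelevant.\<close>

definition simple_spectrum ::
  "(real^'d::finite) set \<Rightarrow> nat \<Rightarrow> ('d list \<Rightarrow> real^'d \<Rightarrow> complex) \<Rightarrow> (nat \<Rightarrow> real) \<Rightarrow> bool" where
  "simple_spectrum \<Omega> k a \<mu> \<longleftrightarrow>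
     0 < \<mu> 1 \<and> strict_mono_on {1..} \<mu> \<and>
     eigenvalues \<Omega> k a = (\<lambda>n. complex_of_real (\<mu> n)) ` {1..} \<and>
     (\<forall>n\<ge>1. simple_eigenvalue \<Omega> k a (complex_of_real (\<mu> n)))"

section \<open>Optimal bi-orthogonal functions\<close>

definition biorthogonal ::
  "(nat \<Rightarrow> real) \<Rightarrow> nat \<Rightarrow> nat \<Rightarrow> (real \<Rightarrow> complex) \<Rightarrow> bool" where
  "biorthogonal \<mu> N k f \<longleftrightarrow> f \<in> L2 (lebesgue_on {0..}) \<and>
     (\<forall>n\<in>{1..N}. (LINT t|lebesgue_on {0..}. of_real (exp (- \<mu> n * t)) * f t) =
        (if k = n then 1 else 0))"

definition optimal_biorthogonal ::
  "(nat \<Rightarrow> real) \<Rightarrow> nat \<Rightarrow> nat \<Rightarrow> (real \<Rightarrow> complex) \<Rightarrow> bool" where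
  "optimal_biorthogonal \<mu> N k f \<longleftrightarrow> biorthogonal \<mu> N k f \<and>
     (\<forall>g. biorthogonal \<mu> N k g \<longrightarrow>
        L2norm (lebesgue_on {0..}) f \<le> L2norm (lebesgue_on {0..}) g)"

text \<open>Absolute convergence of \<open>lim\<^sub>N \<nu>\<^sub>N\<close> for \<open>\<nu>\<^sub>N = \<Sum>\<^sub>n\<^sub>\<le>\<^sub>N m\<^sub>n \<phi>\<^sub>n\<^sup>N\<close>, where the \<open>n\<close>-th summand itself
  depends on \<open>N\<close>; \<open>\<phi> N n\<close> is the function of index \<open>n\<close> for the first \<open>N\<close> moments.\<close>

definition abs_convergent_solution ::
  "(nat \<Rightarrow> complex) \<Rightarrow> (nat \<Rightarrow> nat \<Rightarrow> real \<Rightarrow> complex) \<Rightarrow> bool" where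
  "abs_convergent_solution m \<phi> \<longleftrightarrow>
     bdd_above ((\<lambda>N. \<Sum>n=1..N. cmod (m n) * L2norm (lebesgue_on {0..}) (\<phi> N n)) ` {1..})"

end

theory Submission
  imports Defs
begin

text \<open>Fix \<open>n\<close> with \<open>m\<^sub>n \<noteq> 0\<close> and put \<open>\<delta> = \<mu>\<^sub>1 / 2\<close>. Von Golitschek's proof of the Muentz theorem
  yields a combination \<open>F = e\<^sub>n - \<Sum>\<^sub>k\<^sub>\<noteq>\<^sub>n c\<^sub>k e\<^sub>k\<close> of the exponentials \<open>e\<^sub>k = exp (-\<mu>\<^sub>k t)\<close>, \<open>k \<le> N\<close>, with
  \<open>|F(t)| \<le> B\<^sub>N exp (-\<delta>t)\<close> and \<open>B\<^sub>N = \<Prod>\<^sub>k\<^sub>\<noteq>\<^sub>n |1 - (\<mu>\<^sub>n - \<delta>) / (\<mu>\<^sub>k - \<delta>)|\<close>. The divergence of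
  \<open>\<Sum> 1/\<mu>\<^sub>k\<close> gives \<open>B\<^sub>N \<rightarrow> 0\<close>. Every bi-orthogonal function satisfies \<open>1 = \<integral> F \<phi>\<^sub>n\<close>, so its norm
  tends to infinity with \<open>N\<close>, and the \<open>n\<close>-th summand alone is unbounded.\<close>

section \<open>Exponential sums on the half-line with small supremum\<close>

text \<open>Comparison with the primitive of the bound: \<open>C / l * exp (l * x)\<close> plus or
  minus \<open>G x\<close> is non-decreasing and non-negative at 0. The constant
  \<open>- C / l\<close> of the sharp estimate is dropped, so that multiplication by
  \<open>exp (- l * t)\<close> leaves a bound free of \<open>t\<close>.\<close>

lemma abs_le_of_abs_deriv_le_exp:
  fixes G G' :: "real \<Rightarrow> real" and l C t :: real
  assumes l: "l > 0" and C: "C \<ge> 0" and t: "t \<ge> 0" and G0: "G 0 = 0"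
    and deriv: "\<And>x. (G has_real_derivative G' x) (at x)"
    and le: "\<And>x. x \<ge> 0 \<Longrightarrow> \<bar>G' x\<bar> \<le> C * exp (l * x)"
  shows "\<bar>G t\<bar> \<le> C / l * exp (l * t)"
proof -
  have "C / l * exp (l * 0) - G 0 \<le> C / l * exp (l * t) - G t"
  proof (rule DERIV_nonneg_imp_nondecreasing[OF t])
    fix x :: real assume x: "0 \<le> x" "x \<le> t"
    have "((\<lambda>x. C / l * exp (l * x) - G x) has_real_derivative C * exp (l * x) - G' x) (at x)"
      using l by (auto intro!: derivative_eq_intros deriv)
    then show "\<exists>y. ((\<lambda>x. C / l * exp (l * x) - G x) has_real_derivative y) (at x) \<and> 0 \<le> y"
      using le[OF x(1)] by (intro exI conjI) (assumption, linarith)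
  qed
  moreover have "C / l * exp (l * 0) + G 0 \<le> C / l * exp (l * t) + G t"
  proof (rule DERIV_nonneg_imp_nondecreasing[OF t])
    fix x :: real assume x: "0 \<le> x" "x \<le> t"
    have "((\<lambda>x. C / l * exp (l * x) + G x) has_real_derivative C * exp (l * x) + G' x) (at x)"
      using l by (auto intro!: derivative_eq_intros deriv)
    then show "\<exists>y. ((\<lambda>x. C / l * exp (l * x) + G x) has_real_derivative y) (at x) \<and> 0 \<le> y"
      using le[OF x(1)] by (intro exI conjI) (assumption, linarith)
  qed
  moreover have "C / l \<ge> 0" using l C by simp
  ultimately show ?thesis using G0 by simp
qed

text \<open>Induction on \<open>S\<close>, starting from \<open>exp (- p * t) \<le> 1\<close>. A new
  exponent \<open>l\<close> enters through integration against \<open>exp (l * s)\<close>: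
  normalising the coefficient of \<open>exp (- p * t)\<close> to 1 costs
  \<open>\<bar>l - p\<bar>\<close> and the integration gains \<open>1 / l\<close>, which together
  make the new factor of the product.\<close>

lemma exp_combination_bound:
  fixes \<nu> :: "nat \<Rightarrow> real" and p :: real
  assumes "finite S" and "inj_on \<nu> S" and "\<And>k. k \<in> S \<Longrightarrow> \<nu> k > 0" and "p \<notin> \<nu> ` S" and "p > 0"
  shows "\<exists>c. \<forall>t\<ge>0. \<bar>exp (- p * t) - (\<Sum>k\<in>S. c k * exp (- \<nu> k * t))\<bar>
    \<le> (\<Prod>k\<in>S. \<bar>1 - p / \<nu> k\<bar>)"
  using assms
proof (induction S rule: finite_induct)
  case empty
  then show ?case by auto
next
  case (insert j S)
  then obtain c where c: "\<And>t. t \<ge> 0 \<Longrightarrow>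
    \<bar>exp (- p * t) - (\<Sum>k\<in>S. c k * exp (- \<nu> k * t))\<bar> \<le> (\<Prod>k\<in>S. \<bar>1 - p / \<nu> k\<bar>)"
    by (auto simp: inj_on_insert)
  define B where "B = (\<Prod>k\<in>S. \<bar>1 - p / \<nu> k\<bar>)"
  define l where "l = \<nu> j"
  have l: "l > 0" "l \<noteq> p" "\<And>k. k \<in> S \<Longrightarrow> l \<noteq> \<nu> k"
    using insert.prems insert.hyps by (auto simp: l_def)
  define P where "P = (\<lambda>t. exp (- p * t) - (\<Sum>k\<in>S. c k * exp (- \<nu> k * t)))"
  \<comment> \<open>\<open>exp (- l * t) * G t\<close> is \<open>(l - p) * exp (- l * t)\<close> times the integral of \<open>exp (l * s) * P s\<close> over
    \<open>[0, t]\<close>, which is again a combination of exponentials with \<open>exp (- p * t)\<close> having coefficient 1.\<close>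
  define G where "G = (\<lambda>t. (exp ((l - p) * t) - 1)
    - (\<Sum>k\<in>S. (l - p) * c k / (l - \<nu> k) * (exp ((l - \<nu> k) * t) - 1)))"
  \<comment> \<open>The terms \<open>- 1\<close> in \<open>G\<close>, which come from the lower
    limit of integration, all turn into multiples of \<open>exp (- l * t)\<close>; they are
    collected in the coefficient of index \<open>j\<close>.\<close>
  define c' where "c' = (\<lambda>k. if k = j then 1 - (\<Sum>k\<in>S. (l - p) * c k / (l - \<nu> k))
    else (l - p) * c k / (l - \<nu> k))"
  have deriv: "(G has_real_derivative (l - p) * (exp (l * x) * P x)) (at x)" for x
  proof -
    have e: "exp ((l - b) * x) = exp (l * x) * exp (- b * x)" for b
      by (simp add: left_diff_distrib flip: exp_add)
    have d_exp: "((\<lambda>x. exp (b * x) - 1) has_real_derivative b * exp (b * x)) (at x)" for b :: real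
      by (auto intro!: derivative_eq_intros)
    have "(G has_real_derivative (l - p) * exp ((l - p) * x)
      - (\<Sum>k\<in>S. (l - p) * c k / (l - \<nu> k) * ((l - \<nu> k) * exp ((l - \<nu> k) * x)))) (at x)"
      unfolding G_def by (intro DERIV_diff DERIV_sum DERIV_cmult d_exp)
    also have "(\<Sum>k\<in>S. (l - p) * c k / (l - \<nu> k) * ((l - \<nu> k) * exp ((l - \<nu> k) * x)))
      = (\<Sum>k\<in>S. (l - p) * (exp (l * x) * (c k * exp (- \<nu> k * x))))"
      using l(3) by (intro sum.cong refl) (simp add: e)
    also have "(l - p) * exp ((l - p) * x) - \<dots> = (l - p) * (exp (l * x) * P x)"
      unfolding P_def e by (simp only: right_diff_distrib[of _ "exp (- p * x)"]
          right_diff_distrib[of _ "_ * exp (- p * x)"] sum_distrib_left)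
    finally show ?thesis .
  qed
  have "\<bar>exp (- p * t) - (\<Sum>k\<in>insert j S. c' k * exp (- \<nu> k * t))\<bar> \<le> \<bar>1 - p / l\<bar> * B"
    if t: "t \<ge> 0" for t
  proof -
    have "\<bar>G t\<bar> \<le> (\<bar>l - p\<bar> * B) / l * exp (l * t)"
    proof (rule abs_le_of_abs_deriv_le_exp[OF l(1) _ t _ deriv])
      show "0 \<le> \<bar>l - p\<bar> * B" by (simp add: B_def prod_nonneg)
      show "G 0 = 0" by (simp add: G_def)
      fix x :: real assume "x \<ge> 0"
      then have "\<bar>P x\<bar> \<le> B" using c by (simp add: P_def B_def)
      then show "\<bar>(l - p) * (exp (l * x) * P x)\<bar> \<le> \<bar>l - p\<bar> * B * exp (l * x)"
        by (simp add: abs_mult mult.assoc mult.commute[of B] mult_left_mono)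
    qed
    also have "(\<bar>l - p\<bar> * B) / l = \<bar>1 - p / l\<bar> * B"
    proof -
      have "1 - p / l = (l - p) / l" using l by (simp add: field_simps)
      then show ?thesis using l by (simp add: abs_divide)
    qed
    finally have "exp (- l * t) * \<bar>G t\<bar> \<le> exp (- l * t) * (\<bar>1 - p / l\<bar> * B * exp (l * t))"
      by (intro mult_left_mono) auto
    then have "\<bar>exp (- l * t) * G t\<bar> \<le> \<bar>1 - p / l\<bar> * B"
      by (simp add: abs_mult exp_minus field_simps)
    moreover have "exp (- l * t) * G t
      = exp (- p * t) - (\<Sum>k\<in>insert j S. c' k * exp (- \<nu> k * t))"
    proof -
      have e: "exp (- l * t) * (exp ((l - b) * t) - 1) = exp (- b * t) - exp (- l * t)" for b
        by (simp add: right_diff_distrib left_diff_distrib flip: exp_add)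
      have "exp (- l * t) * G t = exp (- l * t) * (exp ((l - p) * t) - 1)
        - (\<Sum>k\<in>S. exp (- l * t) * ((l - p) * c k / (l - \<nu> k) * (exp ((l - \<nu> k) * t) - 1)))"
        unfolding G_def
        by (simp only: right_diff_distrib[of _ "exp ((l - p) * t) - 1"] sum_distrib_left)
      also have "\<dots> = (exp (- p * t) - exp (- l * t))
        - (\<Sum>k\<in>S. (l - p) * c k / (l - \<nu> k) * (exp (- \<nu> k * t) - exp (- l * t)))"
        by (simp only: mult.left_commute[of "exp (- l * t)"] e)
      also have "\<dots> = (exp (- p * t) - exp (- l * t))
        - ((\<Sum>k\<in>S. (l - p) * c k / (l - \<nu> k) * exp (- \<nu> k * t))
          - (\<Sum>k\<in>S. (l - p) * c k / (l - \<nu> k)) * exp (- l * t))"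
        by (simp only: right_diff_distrib[of _ "exp _" "exp _"] sum_subtractf sum_distrib_right)
      also have "(\<Sum>k\<in>S. (l - p) * c k / (l - \<nu> k) * exp (- \<nu> k * t))
          = (\<Sum>k\<in>S. c' k * exp (- \<nu> k * t))"
        using insert.hyps by (intro sum.cong) (auto simp: c'_def)
      finally show ?thesis
        using insert.hyps by (simp add: c'_def algebra_simps flip: l_def)
    qed
    ultimately show ?thesis by simp
  qed
  then show ?case using insert.hyps by (auto simp: B_def l_def)
qed

section \<open>Pairing exponential sums with bi-orthogonal functions\<close>

lemma integrable_exp_atLeast_0:
  fixes b :: real
  assumes "b > 0"
  shows "integrable (lebesgue_on {0..}) (\<lambda>t. exp (- b * t))"
proof -
  have "(\<lambda>t. exp (- b * t)) absolutely_integrable_on {0..}"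
    using integrable_on_exp_minus_to_infinity[of b 0] assms
    by (intro nonnegative_absolutely_integrable_1) auto
  then show ?thesis
    by (simp add: absolutely_integrable_on_def set_integrable_def integrable_restrict_space mult.commute)
qed

text \<open>A pointwise substitute for Cauchy-Schwarz: it provides both an integrable majorant and
  the integral estimate. The resulting bound involves the squared norm plus a constant, which is
  enough to force the norm to infinity.\<close>

lemma exp_mult_le:
  fixes b t y :: real
  assumes "y \<ge> 0"
  shows "exp (- b * t) * y \<le> exp (- (2 * b) * t) + y\<^sup>2"
proof -
  have "exp (- (2 * b) * t) = (exp (- b * t))\<^sup>2"
    by (simp add: power2_eq_square flip: exp_add)
  moreover have "exp (- b * t) * y \<ge> 0" using assms by simp
  ultimately show ?thesis using sum_squares_bound[of "exp (- b * t)" y] by linarith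
qed

lemma integrable_exp_mult_L2:
  assumes b: "b > 0" and f: "f \<in> L2 (lebesgue_on {0..})"
  shows "integrable (lebesgue_on {0..}) (\<lambda>t. complex_of_real (exp (- b * t)) * f t)"
proof (rule Bochner_Integration.integrable_bound)
  show "integrable (lebesgue_on {0..}) (\<lambda>t. exp (- (2 * b) * t) + (cmod (f t))\<^sup>2)"
    using integrable_exp_atLeast_0[of "2 * b"] b f unfolding L2_def
    by (intro Bochner_Integration.integrable_add) auto
  show "(\<lambda>t. complex_of_real (exp (- b * t)) * f t) \<in> borel_measurable (lebesgue_on {0..})"
    using integrable_exp_atLeast_0[OF b] f unfolding L2_def
    by (intro borel_measurable_times borel_measurable_of_real) auto
  show "AE t in lebesgue_on {0..}. norm (complex_of_real (exp (- b * t)) * f t)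
    \<le> norm (exp (- (2 * b) * t) + (cmod (f t))\<^sup>2)"
    using exp_mult_le[of "cmod (f _)" b] by (simp add: norm_mult)
qed

text \<open>Duality: integrating the combination against \<open>f\<close> annihilates every term
  with \<open>k \<noteq> n\<close> and yields 1, while the decay \<open>exp (- d * t)\<close> keeps
  the same integral below a multiple of \<open>B\<close>.\<close>

lemma biorthogonal_combination_ge:
  fixes \<mu> :: "nat \<Rightarrow> real"
  assumes bi: "biorthogonal \<mu> N n f" and n: "n \<in> {1..N}" and pos: "\<And>k. k \<in> {1..N} \<Longrightarrow> \<mu> k > 0"
    and d: "d > 0"
    and bound: "\<And>t. t \<ge> 0 \<Longrightarrow>
      \<bar>exp (- \<mu> n * t) - (\<Sum>k\<in>{1..N} - {n}. c k * exp (- \<mu> k * t))\<bar> \<le> B * exp (- d * t)"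
  shows "1 \<le> B * ((LINT t|lebesgue_on {0..}. exp (- (2 * d) * t))
    + (L2norm (lebesgue_on {0..}) f)\<^sup>2)"
proof -
  let ?L = "lebesgue_on {0::real..}"
  let ?e = "\<lambda>k t. complex_of_real (exp (- \<mu> k * t)) * f t"
  let ?F = "\<lambda>t. exp (- \<mu> n * t) - (\<Sum>k\<in>{1..N} - {n}. c k * exp (- \<mu> k * t))"
  have f: "f \<in> L2 ?L" and
    orth: "\<And>k. k \<in> {1..N} \<Longrightarrow> (LINT t|?L. ?e k t) = (if n = k then 1 else 0)"
    using bi by (auto simp: biorthogonal_def)
  have int: "integrable ?L (?e k)" if "k \<in> {1..N}" for k
    using integrable_exp_mult_L2[OF pos[OF that] f] .
  have B: "B \<ge> 0" using bound[of 0] by simp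
  have F: "complex_of_real (?F t) * f t
      = ?e n t - (\<Sum>k\<in>{1..N} - {n}. complex_of_real (c k) * ?e k t)" for t
    by (simp add: left_diff_distrib sum_distrib_right mult.assoc)
  have intF: "integrable ?L (\<lambda>t. complex_of_real (?F t) * f t)"
    unfolding F using int n by (intro Bochner_Integration.integrable_diff
        Bochner_Integration.integrable_sum integrable_mult_right) auto
  have "(LINT t|?L. complex_of_real (?F t) * f t)
      = (LINT t|?L. ?e n t) - (LINT t|?L. (\<Sum>k\<in>{1..N} - {n}. complex_of_real (c k) * ?e k t))"
    unfolding F using int n by (intro Bochner_Integration.integral_diff
        Bochner_Integration.integrable_sum integrable_mult_right) auto
  also have "(LINT t|?L. (\<Sum>k\<in>{1..N} - {n}. complex_of_real (c k) * ?e k t))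
      = (\<Sum>k\<in>{1..N} - {n}. (LINT t|?L. complex_of_real (c k) * ?e k t))"
    using int by (intro Bochner_Integration.integral_sum integrable_mult_right) auto
  also have "\<dots> = 0"
  proof (intro sum.neutral ballI)
    fix k assume "k \<in> {1..N} - {n}"
    then have "(LINT t|?L. ?e k t) = 0" using orth[of k] by auto
    then show "(LINT t|?L. complex_of_real (c k) * ?e k t) = 0" by simp
  qed
  also have "(LINT t|?L. ?e n t) = 1" using orth[OF n] by simp
  finally have one: "(LINT t|?L. complex_of_real (?F t) * f t) = 1" by simp
  have intf: "integrable ?L (\<lambda>t. (cmod (f t))\<^sup>2)" using f by (simp add: L2_def)
  have inte: "integrable ?L (\<lambda>t. exp (- (2 * d) * t))"
    using d by (intro integrable_exp_atLeast_0) auto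
  have "cmod (LINT t|?L. complex_of_real (?F t) * f t)
      \<le> (LINT t|?L. B * (exp (- (2 * d) * t) + (cmod (f t))\<^sup>2))"
  proof (rule Bochner_Integration.integral_norm_bound_integral[OF intF])
    show "integrable ?L (\<lambda>t. B * (exp (- (2 * d) * t) + (cmod (f t))\<^sup>2))"
      using intf inte by (intro integrable_mult_right Bochner_Integration.integrable_add)
    fix t assume "t \<in> space ?L"
    then have t: "t \<ge> 0" by simp
    have "norm (complex_of_real (?F t) * f t) = \<bar>?F t\<bar> * cmod (f t)"
      by (simp only: norm_mult norm_of_real)
    also have "\<dots> \<le> B * exp (- d * t) * cmod (f t)"
      using bound[OF t] by (rule mult_right_mono) simp
    also have "\<dots> \<le> B * (exp (- (2 * d) * t) + (cmod (f t))\<^sup>2)"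
      using mult_left_mono[OF exp_mult_le B, of "cmod (f t)" d t] by (simp only: mult.assoc norm_ge_zero)
    finally show "norm (complex_of_real (?F t) * f t)
      \<le> B * (exp (- (2 * d) * t) + (cmod (f t))\<^sup>2)" .
  qed
  also have "\<dots> = B * ((LINT t|?L. exp (- (2 * d) * t)) + (LINT t|?L. (cmod (f t))\<^sup>2))"
    using intf inte by simp
  also have "(LINT t|?L. (cmod (f t))\<^sup>2) = (L2norm ?L f)\<^sup>2"
    by (simp add: L2norm_def)
  finally show ?thesis unfolding one by simp
qed

text \<open>A bound that is merely uniform in \<open>t\<close> cannot be paired with a
  square-integrable function on the half-line. Hence \<open>exp_combination_bound\<close> is applied
  to the shifted exponents \<open>\<mu> k - d\<close>, and multiplication by
  \<open>exp (- d * t)\<close> restores \<open>\<mu> k\<close> and supplies the decay.\<close>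

lemma biorthogonal_weight_ge:
  fixes \<mu> :: "nat \<Rightarrow> real"
  assumes "biorthogonal \<mu> N n f" and n: "n \<in> {1..N}" and d: "d > 0"
    and gt: "\<And>k. k \<in> {1..N} \<Longrightarrow> \<mu> k > d" and inj: "inj_on \<mu> {1..N}"
  shows "1 \<le> (\<Prod>k\<in>{1..N} - {n}. \<bar>1 - (\<mu> n - d) / (\<mu> k - d)\<bar>) *
    ((LINT t|lebesgue_on {0..}. exp (- (2 * d) * t)) + (L2norm (lebesgue_on {0..}) f)\<^sup>2)"
proof -
  have "\<exists>c. \<forall>t\<ge>0. \<bar>exp (- (\<mu> n - d) * t) - (\<Sum>k\<in>{1..N} - {n}. c k * exp (- (\<mu> k - d) * t))\<bar>
    \<le> (\<Prod>k\<in>{1..N} - {n}. \<bar>1 - (\<mu> n - d) / (\<mu> k - d)\<bar>)"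
  proof (rule exp_combination_bound)
    show "inj_on (\<lambda>k. \<mu> k - d) ({1..N} - {n})"
      by (rule inj_onI, rule inj_onD[OF inj]) simp_all
    show "\<mu> n - d \<notin> (\<lambda>k. \<mu> k - d) ` ({1..N} - {n})"
    proof
      assume "\<mu> n - d \<in> (\<lambda>k. \<mu> k - d) ` ({1..N} - {n})"
      then obtain j where "\<mu> n - d = \<mu> j - d" "j \<in> {1..N} - {n}" by (rule imageE)
      then show False using inj_onD[OF inj, of n j] n by auto
    qed
  qed (use gt n in \<open>simp_all\<close>)
  then obtain c where c: "\<And>t. t \<ge> 0 \<Longrightarrow>
    \<bar>exp (- (\<mu> n - d) * t) - (\<Sum>k\<in>{1..N} - {n}. c k * exp (- (\<mu> k - d) * t))\<bar>
    \<le> (\<Prod>k\<in>{1..N} - {n}. \<bar>1 - (\<mu> n - d) / (\<mu> k - d)\<bar>)"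
    by blast
  show ?thesis
  proof (rule biorthogonal_combination_ge[where c = c, OF assms(1) n _ d])
    show "\<mu> k > 0" if "k \<in> {1..N}" for k using gt[OF that] d by simp
    fix t :: real assume t: "t \<ge> 0"
    have e: "exp (- b * t) = exp (- (b - d) * t) * exp (- d * t)" for b
      by (simp add: algebra_simps flip: exp_add)
    have "exp (- \<mu> n * t) - (\<Sum>k\<in>{1..N} - {n}. c k * exp (- \<mu> k * t))
      = (exp (- (\<mu> n - d) * t) - (\<Sum>k\<in>{1..N} - {n}. c k * exp (- (\<mu> k - d) * t))) * exp (- d * t)"
      unfolding e[of "\<mu> _"] by (simp only: left_diff_distrib sum_distrib_right mult.assoc)
    then show "\<bar>exp (- \<mu> n * t) - (\<Sum>k\<in>{1..N} - {n}. c k * exp (- \<mu> k * t))\<bar>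
      \<le> (\<Prod>k\<in>{1..N} - {n}. \<bar>1 - (\<mu> n - d) / (\<mu> k - d)\<bar>) * exp (- d * t)"
      using mult_right_mono[OF c[OF t], of "exp (- d * t)"] by (simp only: abs_mult abs_exp_cancel exp_ge_zero)
  qed
qed

section \<open>Divergence of the reciprocal series and decay of the product\<close>

text \<open>Factors with \<open>k < n\<close> may exceed 1, but they form a fixed constant
  \<open>A\<close>. Those with \<open>k > n\<close> lie between 0 and 1 and are at most
  \<open>exp (- p / \<mu> k)\<close>, so the divergent sum appears in the exponent.\<close>

lemma Muntz_product_tendsto_0:
  fixes \<mu> :: "nat \<Rightarrow> real"
  assumes mono: "strict_mono_on {1..} \<mu>" and d: "0 < d" "d < \<mu> 1" and n: "n \<ge> 1"
    and div: "filterlim (\<lambda>N. \<Sum>k=1..N. 1 / \<mu> k) at_top sequentially"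
  shows "(\<lambda>N. \<Prod>k\<in>{1..N} - {n}. \<bar>1 - (\<mu> n - d) / (\<mu> k - d)\<bar>) \<longlonglongrightarrow> 0"
proof -
  define p where "p = \<mu> n - d"
  define A where "A = (\<Prod>k\<in>{1..<n}. \<bar>1 - p / (\<mu> k - d)\<bar>)"
  define S where "S = (\<lambda>N. \<Sum>k=1..N. 1 / \<mu> k)"
  have less: "\<mu> i < \<mu> j" if "1 \<le> i" "i < j" for i j
    using mono that by (auto simp: strict_mono_on_def)
  have gt: "\<mu> k > d" if "k \<ge> 1" for k
    using less[of 1 k] that d by (cases "k = 1") auto
  have p: "p > 0" using gt[OF n] by (simp add: p_def)
  have factor: "\<bar>1 - p / (\<mu> k - d)\<bar> \<le> exp (- p * (1 / \<mu> k))" if k: "k > n" for k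
  proof -
    have pos: "\<mu> k - d > 0" "p < \<mu> k - d" using gt[of k] less[OF n k] k by (auto simp: p_def)
    then have "p / (\<mu> k - d) < 1" by simp
    then have "\<bar>1 - p / (\<mu> k - d)\<bar> = 1 - p / (\<mu> k - d)" by simp
    \<comment> \<open>Removing the shift only enlarges the denominator, so the divergence assumed
      for \<open>1 / \<mu> k\<close> applies directly.\<close>
    also have "\<dots> \<le> 1 - p / \<mu> k"
      using pos p d by (simp add: frac_le)
    also have "\<dots> \<le> exp (- p * (1 / \<mu> k))" using exp_ge_add_one_self[of "- p / \<mu> k"] by simp
    finally show ?thesis .
  qed
  \<comment> \<open>The factor \<open>exp (p * S n)\<close> compensates for the first
    \<open>n\<close> terms of \<open>S N\<close>, which do not come from the tail of the
    product.\<close>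
  have le: "(\<Prod>k\<in>{1..N} - {n}. \<bar>1 - p / (\<mu> k - d)\<bar>) \<le> A * exp (p * S n) * exp (- p * S N)"
    if N: "N \<ge> n" for N
  proof -
    have split: "{1..N} - {n} = {1..<n} \<union> {n<..N}" using N n by auto
    have "(\<Prod>k\<in>{1..N} - {n}. \<bar>1 - p / (\<mu> k - d)\<bar>) = A * (\<Prod>k\<in>{n<..N}. \<bar>1 - p / (\<mu> k - d)\<bar>)"
      unfolding split A_def by (rule prod.union_disjoint) auto
    also have "\<dots> \<le> A * (\<Prod>k\<in>{n<..N}. exp (- p * (1 / \<mu> k)))"
      using factor by (intro mult_left_mono prod_mono) (auto simp: A_def intro!: prod_nonneg)
    also have "(\<Prod>k\<in>{n<..N}. exp (- p * (1 / \<mu> k))) = exp (- p * (\<Sum>k\<in>{n<..N}. 1 / \<mu> k))"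
      by (simp only: sum_distrib_left exp_sum finite_greaterThanAtMost)
    also have "(\<Sum>k\<in>{n<..N}. 1 / \<mu> k) = S N - S n"
    proof -
      have "{1..N} = {1..n} \<union> {n<..N}" using N n by auto
      then have "S N = S n + (\<Sum>k\<in>{n<..N}. 1 / \<mu> k)"
        unfolding S_def by (simp only:) (rule sum.union_disjoint, auto)
      then show ?thesis by simp
    qed
    finally show ?thesis by (simp add: right_diff_distrib exp_diff exp_minus field_simps)
  qed
  have "filterlim (\<lambda>N. - p * S N) at_bot sequentially"
    using filterlim_tendsto_pos_mult_at_top[OF tendsto_const p div[folded S_def]]
    by (simp add: filterlim_uminus_at_bot)
  then have "(\<lambda>N. exp (- p * S N)) \<longlonglongrightarrow> 0" by (rule filterlim_compose[OF exp_at_bot])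
  then have lim: "(\<lambda>N. A * exp (p * S n) * exp (- p * S N)) \<longlonglongrightarrow> 0" by (rule tendsto_mult_right_zero)
  show ?thesis unfolding p_def[symmetric]
  proof (rule tendsto_sandwich[OF _ _ tendsto_const lim])
    show "\<forall>\<^sub>F N in sequentially. 0 \<le> (\<Prod>k\<in>{1..N} - {n}. \<bar>1 - p / (\<mu> k - d)\<bar>)"
      by (intro always_eventually allI prod_nonneg) simp
    show "\<forall>\<^sub>F N in sequentially. (\<Prod>k\<in>{1..N} - {n}. \<bar>1 - p / (\<mu> k - d)\<bar>)
        \<le> A * exp (p * S n) * exp (- p * S N)"
      by (rule eventually_sequentiallyI[of n]) (rule le)
  qed
qed

section \<open>Unboundedness of a single non-zero summand\<close>

theorem theorem3p10:
  fixes \<Omega> :: "(real^'d::finite) set"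
    and k :: nat
    and a :: "'d list \<Rightarrow> real^'d \<Rightarrow> complex"
    and \<mu> :: "nat \<Rightarrow> real"
    and M \<sigma> \<beta> \<theta> s :: real
    and m :: "nat \<Rightarrow> complex"
    and \<phi> :: "nat \<Rightarrow> nat \<Rightarrow> real \<Rightarrow> complex"
  assumes "elliptic_dirichlet_operator \<Omega> k a"
    and "simple_spectrum \<Omega> k a \<mu>"
    and "M > 0" and "0 < \<sigma>" and "\<sigma> \<le> 1"
    and "\<exists>\<epsilon>. \<epsilon> \<in> o(\<lambda>n. real n powr (- \<sigma>)) \<and>
          (\<forall>n\<ge>1. \<mu> n = M * real n powr \<beta> * (1 + \<epsilon> n))"
    and "\<theta> > 0" and "s \<ge> 0"
    and "\<forall>n\<ge>1. \<mu> (n + 1) - \<mu> n \<ge> \<theta> * real n powr (- s)"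
    and "filterlim (\<lambda>N. \<Sum>n=1..N. 1 / \<mu> n) at_top sequentially"
    and "\<forall>N\<ge>1. \<forall>n\<in>{1..N}. optimal_biorthogonal \<mu> N n (\<phi> N n)"
    and "0 \<le> \<beta>" and "\<beta> \<le> 1"
    and "\<not> (\<forall>n\<ge>1. m n = 0)"
  shows "\<not> abs_convergent_solution m \<phi>"
proof
  assume bdd: "abs_convergent_solution m \<phi>"
  have mono: "strict_mono_on {1..} \<mu>" and \<mu>1: "0 < \<mu> 1"
    using assms(2) by (auto simp: simple_spectrum_def)
  obtain n where n: "n \<ge> 1" "m n \<noteq> 0" using assms(14) by blast
  let ?norm = "L2norm (lebesgue_on {0::real..})"
  have norm_nonneg: "?norm f \<ge> 0" for f by (simp add: L2norm_def)
  obtain K where K: "\<And>N. N \<ge> 1 \<Longrightarrow> (\<Sum>j=1..N. cmod (m j) * ?norm (\<phi> N j)) \<le> K"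
    using bdd by (auto simp: abs_convergent_solution_def bdd_above_def)
  \<comment> \<open>All summands are non-negative, so the bound on the sum passes to the one of
    index \<open>n\<close>, which is present once \<open>N \<ge> n\<close>.\<close>
  have norm_le: "?norm (\<phi> N n) \<le> K / cmod (m n)" if N: "N \<ge> n" for N
  proof -
    have "cmod (m n) * ?norm (\<phi> N n) \<le> (\<Sum>j=1..N. cmod (m j) * ?norm (\<phi> N j))"
      using n N norm_nonneg
      by (intro member_le_sum[where f = "\<lambda>j. cmod (m j) * ?norm (\<phi> N j)"]) auto
    also have "\<dots> \<le> K" using K n N by simp
    finally show ?thesis using n by (simp add: field_simps)
  qed
  \<comment> \<open>Any value strictly between 0 and \<open>\<mu> 1\<close> would do: the decay rate
    and all shifted exponents must be positive.\<close>
  define d where "d = \<mu> 1 / 2"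
  have d: "0 < d" "d < \<mu> 1" using \<mu>1 by (auto simp: d_def)
  define B where "B = (\<lambda>N. \<Prod>k\<in>{1..N} - {n}. \<bar>1 - (\<mu> n - d) / (\<mu> k - d)\<bar>)"
  define C where "C = (LINT t|lebesgue_on {0..}. exp (- (2 * d) * t)) + (K / cmod (m n))\<^sup>2"
  have gt: "\<mu> j > d" if "j \<ge> 1" for j
    using strict_mono_onD[OF mono, of 1 j] that d by (cases "j = 1") auto
  \<comment> \<open>The uniform norm bound makes \<open>C\<close> independent of \<open>N\<close>,
    so this inequality is incompatible with \<open>B N\<close> tending to 0.\<close>
  have "1 \<le> B N * C" if N: "N \<ge> n" for N
  proof -
    have "biorthogonal \<mu> N n (\<phi> N n)"
      using assms(11) n N by (auto simp: optimal_biorthogonal_def)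
    then have "1 \<le> B N * ((LINT t|lebesgue_on {0..}. exp (- (2 * d) * t)) + (?norm (\<phi> N n))\<^sup>2)"
      unfolding B_def
    proof (rule biorthogonal_weight_ge)
      show "inj_on \<mu> {1..N}"
        using strict_mono_on_imp_inj_on[OF mono] by (rule inj_on_subset) auto
    qed (use n N d gt in auto)
    also have "\<dots> \<le> B N * C"
      unfolding C_def using norm_le[OF N] norm_nonneg
      by (intro mult_left_mono add_left_mono power_mono) (auto simp: B_def intro!: prod_nonneg)
    finally show ?thesis .
  qed
  moreover have "(\<lambda>N. B N * C) \<longlonglongrightarrow> 0"
    unfolding B_def using Muntz_product_tendsto_0[OF mono d n(1) assms(10)]
    by (rule tendsto_mult_left_zero)
  ultimately have "(1::real) \<le> 0"
    by (intro tendsto_lowerbound[of "\<lambda>N. B N * C" 0 sequentially])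
      (auto intro!: eventually_sequentiallyI[of n])
  then show False by simp
qed

end
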